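(* For all integers $k\ge 3$ and $q\ge 3$, the graphs $K_k$ and $K_k\cdot K_2$ are not $q$-equivalent.
   Context: All graphs are finite and simple. $K_k\cdot K_2$ is the graph on $k+1$ vertices obtained from $K_k$ by adding a new vertex joined by an edge to exactly one vertex of the $K_k$ (a pendant edge). A graph $G$ is $q$-Ramsey for $H$ if every colouring of $E(G)$ with $q$ colours contains a monochromatic copy of $H$; $G$ is $q$-Ramsey-minimal for $H$ if it is $q$-Ramsey for $H$ but no proper subgraph is; $\mathcal{M}_q(H)$ is the set of such graphs. $H,H'$ are $q$-equivalent if $\mathcal{M}_q(H)=\mathcal{M}_q(H')$. *)

theory Defs
  imports "HOL-Library.Ramsey"
begin

text \<open>
  A graph is a pair of a vertex set and a set of edges, the edges being 2-element sets of
  vertices; \<open>[V]\<^bsup>2\<^esup>\<close> is the library notation for the set of all 2-element subsets of \<open>V\<close>.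
\<close>

type_synonym 'a graph = "'a set \<times> 'a set set"

abbreviation verts :: "'a graph \<Rightarrow> 'a set" where "verts \<equiv> fst"

abbreviation edges :: "'a graph \<Rightarrow> 'a set set" where "edges \<equiv> snd"

definition finite_simple_graph :: "'a graph \<Rightarrow> bool" where
  "finite_simple_graph G \<longleftrightarrow> finite (verts G) \<and> edges G \<subseteq> [verts G]\<^bsup>2\<^esup>"

definition subgraph_of :: "'a graph \<Rightarrow> 'a graph \<Rightarrow> bool" where
  "subgraph_of G' G \<longleftrightarrow>
     finite_simple_graph G' \<and> verts G' \<subseteq> verts G \<and> edges G' \<subseteq> edges G"

definition graph_iso :: "'a graph \<Rightarrow> 'b graph \<Rightarrow> bool" where
  "graph_iso G H \<longleftrightarrow>
     (\<exists>f. bij_betw f (verts G) (verts H) \<and>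
          (\<forall>u\<in>verts G. \<forall>v\<in>verts G. {u, v} \<in> edges G \<longleftrightarrow> {f u, f v} \<in> edges H))"

text \<open>
  The colours are \<open>0, \<dots>, q - 1\<close>. A colouring is a total function on sets, but only its
  values on the edges of \<open>G\<close> are constrained or used.
\<close>

definition edge_colouring :: "nat \<Rightarrow> 'a graph \<Rightarrow> ('a set \<Rightarrow> nat) \<Rightarrow> bool" where
  "edge_colouring q G c \<longleftrightarrow> c \<in> edges G \<rightarrow> {..<q}"

definition has_mono_copy :: "nat \<Rightarrow> 'b graph \<Rightarrow> 'a graph \<Rightarrow> ('a set \<Rightarrow> nat) \<Rightarrow> bool" where
  "has_mono_copy q H G c \<longleftrightarrow>
     (\<exists>H'. subgraph_of H' G \<and> graph_iso H H' \<and> (\<exists>i<q. \<forall>e\<in>edges H'. c e = i))"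

definition q_Ramsey :: "nat \<Rightarrow> 'b graph \<Rightarrow> 'a graph \<Rightarrow> bool" where
  "q_Ramsey q H G \<longleftrightarrow> (\<forall>c. edge_colouring q G c \<longrightarrow> has_mono_copy q H G c)"

definition q_Ramsey_minimal :: "nat \<Rightarrow> 'b graph \<Rightarrow> 'a graph \<Rightarrow> bool" where
  "q_Ramsey_minimal q H G \<longleftrightarrow>
     q_Ramsey q H G \<and> \<not> (\<exists>G'. subgraph_of G' G \<and> G' \<noteq> G \<and> q_Ramsey q H G')"

text \<open>
  The class of all finite simple graphs is represented by the graphs with vertices in \<open>nat\<close>.
  This loses nothing: every finite graph is isomorphic to such a graph, and being
  Ramsey-minimal for \<open>H\<close> is invariant under isomorphism.
\<close>

definition Ramsey_minimal_graphs :: "nat \<Rightarrow> 'b graph \<Rightarrow> nat graph set" where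
  "Ramsey_minimal_graphs q H = {G. finite_simple_graph G \<and> q_Ramsey_minimal q H G}"

definition q_equivalent :: "nat \<Rightarrow> 'a graph \<Rightarrow> 'b graph \<Rightarrow> bool" where
  "q_equivalent q H H' \<longleftrightarrow> Ramsey_minimal_graphs q H = Ramsey_minimal_graphs q H'"

definition complete_graph :: "nat \<Rightarrow> nat graph" where
  "complete_graph k = ({..<k}, [{..<k}]\<^bsup>2\<^esup>)"

text \<open>
  The new vertex is \<open>k\<close>. Joining it to vertex \<open>0\<close> (which exists as soon as \<open>k > 0\<close>) is no
  restriction, since the complete graph is vertex-transitive.
\<close>

definition complete_graph_pendant :: "nat \<Rightarrow> nat graph" where
  "complete_graph_pendant k =
     (insert k (verts (complete_graph k)), insert {0, k} (edges (complete_graph k)))"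

lemma finite_simple_graph_complete: "finite_simple_graph (complete_graph k)"
  by (simp add: finite_simple_graph_def complete_graph_def)

lemma finite_simple_graph_complete_pendant:
  assumes "k > 0"
  shows "finite_simple_graph (complete_graph_pendant k)"
  using assms
  by (auto simp: finite_simple_graph_def complete_graph_pendant_def complete_graph_def nsets_def)

end

theory Submission
  imports Defs
begin

text \<open>
  By induction on \<open>q\<close> there is a finite graph that is \<open>q\<close>-Ramsey for \<open>K_k\<close> and has a
  \<open>q\<close>-colouring in which every monochromatic \<open>K_k\<close> is a whole component of its colour, so that
  there is no monochromatic \<open>K_k\<close> with a pendant edge. One colour: take \<open>K_k\<close>.

  Given such a graph \<open>S\<close> for \<open>q\<close> colours, let \<open>Q\<close> be a largest complete graph that has a
  \<open>(q+1)\<close>-colouring without monochromatic \<open>K_k\<close> and, in one colour \<open>j\<close>, even without \<open>K_(k-1)\<close>.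
  Zykov's construction yields an edge-coloured graph \<open>X\<close> all of whose cliques embed into the
  coloured \<open>Q\<close>, and such that every colouring of its vertices with a prescribed number of colours
  has a clique of size \<open>|Q|\<close> with all vertices of the same colour. Join \<open>S\<close> completely to \<open>X\<close>.
  With \<open>j\<close> on the joining edges and the other \<open>q\<close> colours on \<open>S\<close>, the monochromatic \<open>K_k\<close>
  stay isolated. Conversely, a colouring of the join without monochromatic \<open>K_k\<close> has a copy of
  \<open>Q\<close> in \<open>X\<close> on which, for every vertex \<open>a\<close> of \<open>S\<close>, the edges to \<open>a\<close> have a single colour
  \<open>g a\<close>, and then \<open>Q\<close> has no \<open>K_(k-1)\<close> of colour \<open>g a\<close>. Since \<open>Q\<close> is largest, adding a vertex
  joined to it in a single colour shows that at most one colour on \<open>Q\<close> has no \<open>K_(k-1)\<close>, and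
  that this colour has a \<open>K_(k-2)\<close>. So \<open>g\<close> is constant and its value does not occur on \<open>S\<close>,
  whose remaining \<open>q\<close> colours give a monochromatic \<open>K_k\<close>.
\<close>

subsection \<open>Critical colourings of complete graphs\<close>

definition colour_class :: "'a set set \<Rightarrow> ('a set \<Rightarrow> nat) \<Rightarrow> nat \<Rightarrow> 'a set set" where
  "colour_class E c i = {e \<in> E. c e = i}"

lemma clique_insert:
  "clique (insert a C) E \<longleftrightarrow> clique C E \<and> (\<forall>x\<in>C. x \<noteq> a \<longrightarrow> {a, x} \<in> E)"
  by (auto simp: clique_def insert_commute)

text \<open>\<open>\<rho>\<close> colours the complete graph on \<open>Q\<close>, so
  \<open>UNIV\<close> can serve as edge set: \<open>clique\<close> only looks at pairs inside
  \<open>C\<close>. The colour \<open>j\<close> is one in which an outside vertex can be joined to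
  all of \<open>Q\<close> without creating a monochromatic clique of size \<open>k\<close>.\<close>

definition critical_colouring :: "nat \<Rightarrow> nat \<Rightarrow> nat \<Rightarrow> 'a set \<Rightarrow> ('a set \<Rightarrow> nat) \<Rightarrow> bool" where
  "critical_colouring q k j Q \<rho> \<longleftrightarrow>
     \<rho> \<in> [Q]\<^bsup>2\<^esup> \<rightarrow> {..<q} \<and>
     (\<forall>C\<in>[Q]\<^bsup>(k - 1)\<^esup>. \<not> clique C (colour_class UNIV \<rho> j)) \<and>
     (\<forall>i<q. \<forall>C\<in>[Q]\<^bsup>k\<^esup>. \<not> clique C (colour_class UNIV \<rho> i))"

text \<open>
  A new vertex joined in colour \<open>i\<close> to everything enlarges only the cliques of colour \<open>i\<close>.
\<close>

lemma critical_colouring_insert: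
  assumes v: "v \<notin> Q" and i: "i < q" and k: "k \<ge> 3" and \<psi>: "\<psi> \<in> [Q]\<^bsup>2\<^esup> \<rightarrow> {..<q}"
    and free: "\<And>l C. \<lbrakk>l < q; C \<in> [Q]\<^bsup>k\<^esup>\<rbrakk> \<Longrightarrow> \<not> clique C (colour_class UNIV \<psi> l)"
    and free_i: "\<And>C. C \<in> [Q]\<^bsup>(k - 1)\<^esup> \<Longrightarrow> \<not> clique C (colour_class UNIV \<psi> i)"
    and free_j: "\<And>C. C \<in> [Q]\<^bsup>(if j = i then k - 2 else k - 1)\<^esup> \<Longrightarrow> \<not> clique C (colour_class UNIV \<psi> j)"
  shows "critical_colouring q k j (insert v Q) (\<lambda>e. if v \<in> e then i else \<psi> e)"
proof -
  let ?\<rho> = "\<lambda>e. if v \<in> e then i else \<psi> e"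
  have restrict: "clique (C - {v}) (colour_class UNIV \<psi> l)"
    if "clique C (colour_class UNIV ?\<rho> l)" for C l
    using that by (fastforce simp: clique_def colour_class_def)
  have restrict_in: "\<exists>m\<in>{n - 1, n}. C - {v} \<in> [Q]\<^bsup>m\<^esup> \<and> (m = n \<or> v \<in> C)" if "C \<in> [insert v Q]\<^bsup>n\<^esup>" for C n
    using that by (cases "v \<in> C") (auto simp: nsets_def)
  \<comment> \<open>As \<open>n \<ge> 2\<close>, the clique has a second vertex \<open>w\<close>,
    and the edge \<open>{v, w}\<close> has colour \<open>i\<close>.\<close>
  have colour_v: "l = i" if "clique C (colour_class UNIV ?\<rho> l)" "v \<in> C" "C \<in> [insert v Q]\<^bsup>n\<^esup>" "n \<ge> 2" for C l n
  proof -
    have "card (C - {v}) \<noteq> 0"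
      using that by (auto simp: nsets_def)
    then have "C - {v} \<noteq> {}"
      by (metis card.empty)
    then obtain w where "w \<in> C" "w \<noteq> v"
      by blast
    then have "{v, w} \<in> colour_class UNIV ?\<rho> l"
      using that(1,2) by (simp add: clique_def)
    then show ?thesis
      by (simp add: colour_class_def)
  qed
  have "\<not> clique C (colour_class UNIV ?\<rho> l)" if l: "l < q" and C: "C \<in> [insert v Q]\<^bsup>k\<^esup>" for l C
  proof
    assume cl: "clique C (colour_class UNIV ?\<rho> l)"
    obtain m where m: "m \<in> {k - 1, k}" "C - {v} \<in> [Q]\<^bsup>m\<^esup>" "m = k \<or> v \<in> C"
      using restrict_in[OF C] by blast
    show False
    proof (cases "m = k")
      case True
      then show ?thesis
        using free[OF l] restrict[OF cl] m(2) by blast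
    next
      case False
      then have "l = i" "C - {v} \<in> [Q]\<^bsup>(k - 1)\<^esup>"
        using colour_v[OF cl _ C] k m by auto
      then show ?thesis
        using free_i restrict[OF cl] by blast
    qed
  qed
  moreover have "\<not> clique C (colour_class UNIV ?\<rho> j)" if C: "C \<in> [insert v Q]\<^bsup>(k - 1)\<^esup>" for C
  proof
    assume cl: "clique C (colour_class UNIV ?\<rho> j)"
    obtain m where m: "m \<in> {k - 1 - 1, k - 1}" "C - {v} \<in> [Q]\<^bsup>m\<^esup>" "m = k - 1 \<or> v \<in> C"
      using restrict_in[OF C] by blast
    have k2: "k - 1 - 1 = k - 2"
      by simp
    show False
    proof (cases "m = k - 1")
      case True
      then have D: "C - {v} \<in> [Q]\<^bsup>(k - 1)\<^esup>"
        using m by blast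
      show ?thesis
      proof (cases "j = i")
        case True
        then show ?thesis
          using free_i[OF D] restrict[OF cl] by blast
      next
        case False
        then have "\<not> clique (C - {v}) (colour_class UNIV \<psi> j)"
          using free_j[of "C - {v}"] D by presburger
        then show ?thesis
          using restrict[OF cl] by blast
      qed
    next
      case False
      then have "v \<in> C" and D: "C - {v} \<in> [Q]\<^bsup>(k - 2)\<^esup>"
        using m k2 by auto
      then have "j = i"
        using colour_v[OF cl _ C] k by simp
      then have "\<not> clique (C - {v}) (colour_class UNIV \<psi> j)"
        using free_j[of "C - {v}"] D by presburger
      then show ?thesis
        using restrict[OF cl] by blast
    qed
  qed
  moreover have "?\<rho> \<in> [insert v Q]\<^bsup>2\<^esup> \<rightarrow> {..<q}"
    using \<psi> i by (auto simp: nsets_def Pi_iff)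
  ultimately show ?thesis
    by (auto simp: critical_colouring_def)
qed

text \<open>Ramsey's theorem for \<open>q\<close> colours. The bound is uniform in \<open>j\<close>
  and \<open>\<rho>\<close>, so that a maximum over all of them exists.\<close>

lemma card_critical_colouring_bounded:
  "\<exists>N. \<forall>j (Q :: 'a set) \<rho>. finite Q \<longrightarrow> critical_colouring q k j Q \<rho> \<longrightarrow> card Q < N"
proof -
  obtain N where N: "partn_lst {..<N :: nat} (replicate q k) 2"
    using ramsey_full by blast
  have "card Q < N" if "finite Q" "critical_colouring q k j Q \<rho>" for j and Q :: "'a set" and \<rho>
  proof (rule ccontr)
    assume "\<not> card Q < N"
    then have "card {..<N} \<le> card Q"
      by simp
    then obtain h where h: "h ` {..<N} \<subseteq> Q" "inj_on h {..<N}"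
      using card_le_inj[OF finite_lessThan \<open>finite Q\<close>] by blast
    have "(\<lambda>e. \<rho> (h ` e)) \<in> [{..<N}]\<^bsup>2\<^esup> \<rightarrow> {..<q}"
    proof
      fix e assume "e \<in> [{..<N}]\<^bsup>2\<^esup>"
      then have "h ` e \<in> [Q]\<^bsup>2\<^esup>"
        using h by (auto simp: nsets_def card_image inj_on_subset)
      then show "\<rho> (h ` e) \<in> {..<q}"
        using that by (auto simp: critical_colouring_def)
    qed
    then obtain i H where i: "i < q" and H: "H \<in> [{..<N}]\<^bsup>k\<^esup>"
        and mono: "(\<lambda>e. \<rho> (h ` e)) ` [H]\<^bsup>2\<^esup> \<subseteq> {i}"
      using partn_lstE[OF N, of _ q] by (metis length_replicate nth_replicate)
    have "h ` H \<in> [Q]\<^bsup>k\<^esup>"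
      using h H by (auto simp: nsets_def card_image inj_on_subset)
    moreover have "\<rho> {h x, h y} = i" if "x \<in> H" "y \<in> H" "x \<noteq> y" for x y
    proof -
      have "{x, y} \<in> [H]\<^bsup>2\<^esup>"
        using that by simp
      then have "\<rho> (h ` {x, y}) \<in> {i}"
        using mono by blast
      then show ?thesis
        by simp
    qed
    then have "clique (h ` H) (colour_class UNIV \<rho> i)"
      by (auto simp: clique_def colour_class_def)
    ultimately show False
      using that i by (auto simp: critical_colouring_def)
  qed
  then show ?thesis
    by blast
qed

lemma ex_maximal_critical_colouring:
  assumes q: "q > 0" and k: "k \<ge> 3"
  obtains j \<rho> and Q :: "nat set" where "j < q" "finite Q" "critical_colouring q k j Q \<rho>"
    "\<And>j' (Q' :: nat set) \<rho>'. \<lbrakk>j' < q; finite Q'; critical_colouring q k j' Q' \<rho>'\<rbrakk> \<Longrightarrow> card Q' \<le> card Q"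
proof -
  define P where "P n \<longleftrightarrow> (\<exists>j (Q :: nat set) \<rho>. j < q \<and> finite Q \<and> critical_colouring q k j Q \<rho> \<and> card Q = n)" for n
  obtain N where "\<And>j (Q :: nat set) \<rho>. \<lbrakk>finite Q; critical_colouring q k j Q \<rho>\<rbrakk> \<Longrightarrow> card Q < N"
    using card_critical_colouring_bounded[where 'a=nat, of q k] by blast
  then have N: "n \<le> N" if "P n" for n
    using that unfolding P_def by (auto intro: less_imp_le)
  \<comment> \<open>A starting point for the maximum: since \<open>k - 1 > 0\<close>, the empty set
    contains no forbidden clique.\<close>
  have "critical_colouring q k 0 ({} :: nat set) (\<lambda>_. 0)"
    using k by (auto simp: critical_colouring_def nsets_empty_iff)
  then have "P 0"
    unfolding P_def using q by (metis card.empty finite.emptyI)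
  then have "P (Greatest P)" and max: "\<And>n. P n \<Longrightarrow> n \<le> Greatest P"
    using N GreatestI_nat[of P 0 N] Greatest_le_nat[of P _ N] by simp_all
  then obtain j and Q :: "nat set" and \<rho> where
    Q: "j < q" "finite Q" "critical_colouring q k j Q \<rho>" "card Q = Greatest P"
    unfolding P_def by blast
  have "card Q' \<le> card Q" if "j' < q" "finite Q'" "critical_colouring q k j' Q' \<rho>'"
    for j' \<rho>' and Q' :: "nat set"
    using max[of "card Q'"] that Q(4) unfolding P_def by auto
  then show ?thesis
    using that Q(1-3) by blast
qed

subsection \<open>Vertex-Ramsey graphs with edge colours\<close>

text \<open>
  Here \<open>d x y = None\<close> means that \<open>x\<close> and \<open>y\<close> are not adjacent, and \<open>d x y = Some i\<close> that
  they are joined by an edge of colour \<open>i\<close>.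
\<close>

definition modelled_on :: "'b set \<Rightarrow> ('b set \<Rightarrow> nat) \<Rightarrow> 'a set \<Rightarrow> ('a \<Rightarrow> 'a \<Rightarrow> nat option) \<Rightarrow> bool" where
  "modelled_on Q \<rho> V d \<longleftrightarrow>
     (\<forall>x y. d x y = d y x) \<and>
     (\<forall>C\<subseteq>V. pairwise (\<lambda>x y. d x y \<noteq> None) C \<longrightarrow>
        (\<exists>f. inj_on f C \<and> f ` C \<subseteq> Q \<and> pairwise (\<lambda>x y. d x y = Some (\<rho> {f x, f y})) C))"

text \<open>The target sizes \<open>a i\<close> may differ between colours because the induction
  lowers them one at a time.\<close>

definition vertex_arrows ::
  "'c set \<Rightarrow> ('c \<Rightarrow> nat) \<Rightarrow> 'a set \<Rightarrow> ('a \<Rightarrow> 'a \<Rightarrow> nat option) \<Rightarrow> bool" where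
  "vertex_arrows R a V d \<longleftrightarrow>
     (\<forall>\<phi>\<in>V \<rightarrow> R. \<exists>i\<in>R. \<exists>C\<in>[V]\<^bsup>a i\<^esup>. pairwise (\<lambda>x y. d x y \<noteq> None) C \<and> (\<forall>x\<in>C. \<phi> x = i))"

text \<open>Zykov's construction leaves the vertex type. Transporting its result back to
  \<open>nat\<close> allows it to be iterated, and allows the vertices to avoid a given finite
  set.\<close>

lemma modelled_arrows_image:
  fixes V :: "'a set" and h :: "'a \<Rightarrow> 'b"
  assumes h: "inj_on h V" and mod: "modelled_on Q \<rho> V d" and arr: "vertex_arrows R a V d"
  shows "\<exists>d'. modelled_on Q \<rho> (h ` V) d' \<and> vertex_arrows R a (h ` V) d'"
proof (intro exI conjI)
  define g where "g = inv_into V h"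
  define d' where "d' = (\<lambda>x y. d (g x) (g y))"
  have gh: "g (h x) = x" if "x \<in> V" for x
    using that h by (simp add: g_def)
  have g_inj: "inj_on g (h ` V)"
    unfolding g_def by (simp add: inj_on_inv_into)
  have gV: "g ` h ` V = V"
    using gh by force
  show "modelled_on Q \<rho> (h ` V) d'"
    unfolding modelled_on_def
  proof (intro conjI allI impI)
    show "d' x y = d' y x" for x y
      using mod by (simp add: modelled_on_def d'_def)
    fix C assume C: "C \<subseteq> h ` V" and cl: "pairwise (\<lambda>x y. d' x y \<noteq> None) C"
    have inj: "inj_on g C"
      using C g_inj inj_on_subset by blast
    have "g ` C \<subseteq> V"
      using C gV by blast
    moreover have "pairwise (\<lambda>x y. d x y \<noteq> None) (g ` C)"
      using cl by (auto simp: pairwise_def d'_def)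
    ultimately obtain f where f: "inj_on f (g ` C)" "f ` g ` C \<subseteq> Q"
        "pairwise (\<lambda>x y. d x y = Some (\<rho> {f x, f y})) (g ` C)"
      using mod unfolding modelled_on_def by meson
    show "\<exists>f. inj_on f C \<and> f ` C \<subseteq> Q \<and> pairwise (\<lambda>x y. d' x y = Some (\<rho> {f x, f y})) C"
    proof (intro exI conjI)
      show "inj_on (f \<circ> g) C"
        using f inj by (simp add: comp_inj_on)
      show "(f \<circ> g) ` C \<subseteq> Q"
        using f by auto
      show "pairwise (\<lambda>x y. d' x y = Some (\<rho> {(f \<circ> g) x, (f \<circ> g) y})) C"
        using f(3) inj by (auto simp: pairwise_def d'_def inj_on_def)
    qed
  qed
  show "vertex_arrows R a (h ` V) d'"
    unfolding vertex_arrows_def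
  proof
    fix \<phi> assume "\<phi> \<in> h ` V \<rightarrow> R"
    then have "\<phi> \<circ> h \<in> V \<rightarrow> R"
      by auto
    then obtain i C where i: "i \<in> R" and C: "C \<in> [V]\<^bsup>a i\<^esup>"
      and cl: "pairwise (\<lambda>x y. d x y \<noteq> None) C" "\<forall>x\<in>C. (\<phi> \<circ> h) x = i"
      using arr unfolding vertex_arrows_def by metis
    have "C \<subseteq> V"
      using C by (simp add: nsets_def)
    then have "h ` C \<in> [h ` V]\<^bsup>a i\<^esup>"
      using C h by (auto simp: nsets_def card_image inj_on_subset)
    moreover have "pairwise (\<lambda>x y. d' x y \<noteq> None) (h ` C)"
      using cl \<open>C \<subseteq> V\<close> by (auto simp: pairwise_def d'_def gh subset_iff)
    ultimately show "\<exists>i\<in>R. \<exists>C\<in>[h ` V]\<^bsup>a i\<^esup>. pairwise (\<lambda>x y. d' x y \<noteq> None) C \<and> (\<forall>x\<in>C. \<phi> x = i)"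
      using i cl by auto
  qed
qed

lemma ex_inj_on_avoiding:
  assumes "finite V" "finite (A :: nat set)"
  shows "\<exists>h :: 'a \<Rightarrow> nat. inj_on h V \<and> h ` V \<inter> A = {}"
proof -
  obtain h :: "'a \<Rightarrow> nat" where h: "inj_on h V"
    using assms(1) finite_imp_inj_to_nat_seg by metis
  obtain N where N: "\<And>x. x \<in> A \<Longrightarrow> x < N"
    using assms(2) by (meson finite_nat_set_iff_bounded)
  have "inj_on (\<lambda>x. h x + N) V" "(\<lambda>x. h x + N) ` V \<inter> A = {}"
    using h N by (auto simp: inj_on_def dest: N)
  then show ?thesis
    by blast
qed

text \<open>
  Zykov's construction: every choice of one clique of size \<open>a i - 1\<close> in each of the disjoint
  graphs \<open>V i\<close> gets its own new vertex, joined to all the chosen cliques. Its vertex colour \<open>i\<close>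
  completes the clique chosen in \<open>V i\<close>. A clique through the new vertex meets only one \<open>V i\<close>,
  and there it has fewer than \<open>card Q\<close> vertices, so the model in \<open>Q\<close> has room for one more.
\<close>

lemma zykov_step:
  fixes V :: "'c \<Rightarrow> 'a set" and d :: "'c \<Rightarrow> 'a \<Rightarrow> 'a \<Rightarrow> nat option"
  assumes R: "finite R" "R \<noteq> {}" and Q: "finite Q"
    and a: "\<And>i. i \<in> R \<Longrightarrow> 0 < a i \<and> a i \<le> card Q"
    and fin: "\<And>i. i \<in> R \<Longrightarrow> finite (V i)"
    and mod: "\<And>i. i \<in> R \<Longrightarrow> modelled_on Q \<rho> (V i) (d i)"
    and arr: "\<And>i. i \<in> R \<Longrightarrow> vertex_arrows R (a(i := a i - 1)) (V i) (d i)"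
  shows "\<exists>(W :: ('c \<times> 'a + ('c \<Rightarrow> 'a set)) set) D.
           finite W \<and> modelled_on Q \<rho> W D \<and> vertex_arrows R a W D"
proof -
  define K where "K i = {C \<in> [V i]\<^bsup>(a i - 1)\<^esup>. pairwise (\<lambda>x y. d i x y \<noteq> None) C}" for i
  have finK: "finite (K i)" if "i \<in> R" for i
    using fin[OF that] by (simp add: K_def finite_imp_finite_nsets)
  \<comment> \<open>\<open>f\<close> embeds the clique \<open>C\<close> into the coloured
    \<open>Q\<close>, and \<open>p\<close> is a spare point of \<open>Q\<close>, kept as the image
    of a new vertex.\<close>
  define ext where "ext i C f p \<longleftrightarrow> inj_on f C \<and> f ` C \<subseteq> Q \<and>
      pairwise (\<lambda>x y. d i x y = Some (\<rho> {f x, f y})) C \<and> p \<in> Q - f ` C" for i C f p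
  have "\<exists>f p. ext i C f p"
    if i: "i \<in> R" and CK: "C \<in> K i" for i C
  proof -
    have C: "C \<subseteq> V i" "finite C" "card C = a i - 1" "pairwise (\<lambda>x y. d i x y \<noteq> None) C"
      using CK by (auto simp: K_def nsets_def)
    then obtain f where f: "inj_on f C" "f ` C \<subseteq> Q" "pairwise (\<lambda>x y. d i x y = Some (\<rho> {f x, f y})) C"
      using mod[OF i] unfolding modelled_on_def by meson
    have "card (f ` C) < card Q"
      using C f a[OF i] by (auto simp: card_image)
    then have "Q - f ` C \<noteq> {}"
      using Q by (metis Diff_eq_empty_iff card_mono finite_imageI C(2) not_less)
    then show ?thesis
      using f unfolding ext_def by blast
  qed
  then obtain F P where F: "\<And>i C. \<lbrakk>i \<in> R; C \<in> K i\<rbrakk> \<Longrightarrow> ext i C (F i C) (P i C)"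
    by metis
  \<comment> \<open>The index keeps the graphs \<open>V i\<close> disjoint; a new vertex is the
    choice function itself.\<close>
  define W where "W = Inl ` (SIGMA i:R. V i) \<union> Inr ` (Pi\<^sub>E R K)"
  \<comment> \<open>The edges from \<open>g\<close> to \<open>g i\<close> get the colours that they
    would have in \<open>Q\<close> if \<open>g\<close> were the spare point
    \<open>P i (g i)\<close>.\<close>
  define N where "N g i x = (if i \<in> R \<and> x \<in> g i
      then Some (\<rho> {P i (g i), F i (g i) x}) else None)" for g i x
  define D where "D u v = (case u of
        Inl (i, x) \<Rightarrow> (case v of Inl (j, y) \<Rightarrow> (if i = j \<and> i \<in> R then d i x y else None) | Inr g \<Rightarrow> N g i x)
      | Inr g \<Rightarrow> (case v of Inl (i, x) \<Rightarrow> N g i x | Inr g' \<Rightarrow> None))" for u v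
  have D_simps: "D (Inl (i, x)) (Inl (j, y)) = (if i = j \<and> i \<in> R then d i x y else None)"
    "D (Inl (i, x)) (Inr g) = N g i x" "D (Inr g) (Inl (i, x)) = N g i x" "D (Inr g) (Inr g') = None"
    for i x j y g g'
    by (simp_all add: D_def)
  have sym_d: "d i x y = d i y x" if "i \<in> R" for i x y
    using mod[OF that] unfolding modelled_on_def by blast
  have "finite W"
    using R fin finK by (simp add: W_def finite_PiE)
  moreover have "modelled_on Q \<rho> W D"
    unfolding modelled_on_def
  proof (intro conjI allI impI)
    show "D u v = D v u" for u v
      using sym_d by (cases u; cases v) (auto simp: D_simps)
    fix C assume CW: "C \<subseteq> W" and cl: "pairwise (\<lambda>u v. D u v \<noteq> None) C"
    show "\<exists>f. inj_on f C \<and> f ` C \<subseteq> Q \<and> pairwise (\<lambda>u v. D u v = Some (\<rho> {f u, f v})) C"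
    proof (cases "\<exists>g. Inr g \<in> C")
      case True
      then obtain g where g: "Inr g \<in> C"
        by blast
      then have gK: "g i \<in> K i" if "i \<in> R" for i
        using CW that by (auto simp: W_def)
      have Inr_unique: "g' = g" if "Inr g' \<in> C" for g'
        using pairwiseD[OF cl that g] by (auto simp: D_simps)
      have Inl_nbr: "i \<in> R \<and> x \<in> g i" if "Inl (i, x) \<in> C" for i x
        using pairwiseD[OF cl g that] by (auto simp: D_simps N_def split: if_splits)
      \<comment> \<open>Different \<open>V i\<close> are not adjacent. If \<open>Inr g\<close> is
        the whole clique, any \<open>i \<in> R\<close> will do.\<close>
      have "\<exists>i\<in>R. \<forall>j x. Inl (j, x) \<in> C \<longrightarrow> j = i"
      proof (cases "\<exists>i x. Inl (i, x) \<in> C")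
        case True
        then obtain i x where ix: "Inl (i, x) \<in> C"
          by blast
        have "j = i" if "Inl (j, y) \<in> C" for j y
        proof (rule ccontr)
          assume "j \<noteq> i"
          then show False
            using pairwiseD[OF cl that ix] by (auto simp: D_simps)
        qed
        then show ?thesis
          using Inl_nbr ix by blast
      qed (use R in blast)
      then obtain i where i: "i \<in> R" and Inl_i: "\<And>j x. Inl (j, x) \<in> C \<Longrightarrow> j = i"
        by blast
      let ?F = "F i (g i)" and ?p = "P i (g i)"
      have C: "C \<subseteq> insert (Inr g) (Inl ` ({i} \<times> g i))"
      proof
        fix u assume "u \<in> C"
        then show "u \<in> insert (Inr g) (Inl ` ({i} \<times> g i))"
          using Inr_unique Inl_nbr Inl_i by (cases u) fastforce+
      qed
      have F': "inj_on ?F (g i)" "?F ` g i \<subseteq> Q" "?p \<in> Q" "\<And>x. x \<in> g i \<Longrightarrow> ?F x \<noteq> ?p"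
        "\<And>x y. \<lbrakk>x \<in> g i; y \<in> g i; x \<noteq> y\<rbrakk> \<Longrightarrow> d i x y = Some (\<rho> {?F x, ?F y})"
        using F[OF i gK[OF i]] unfolding ext_def pairwise_def by (blast, blast, blast, metis DiffE imageI, blast)
      define f where "f = case_sum (\<lambda>(j :: 'c, x). ?F x) (\<lambda>_ :: 'c \<Rightarrow> 'a set. ?p)"
      have f: "f (Inr g) = ?p" "\<And>x. f (Inl (i, x)) = ?F x"
        by (simp_all add: f_def)
      have "inj_on f (insert (Inr g) (Inl ` ({i} \<times> g i)))"
        using F'(1,4) F'(4)[symmetric] by (auto simp: inj_on_def f)
      moreover have "f ` insert (Inr g) (Inl ` ({i} \<times> g i)) \<subseteq> Q"
        using F' by (auto simp: f)
      moreover have "pairwise (\<lambda>u v. D u v = Some (\<rho> {f u, f v})) (insert (Inr g) (Inl ` ({i} \<times> g i)))"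
        using i F' by (auto simp: pairwise_def f D_simps N_def insert_commute)
      ultimately show ?thesis
        using C by (meson inj_on_subset pairwise_subset image_mono subset_trans)
    next
      case False
      show ?thesis
      proof (cases "C = {}")
        case True
        then show ?thesis by auto
      next
        case nonempty: False
        then obtain i x where ix: "Inl (i, x) \<in> C"
          using False by (metis ex_in_conv old.prod.exhaust sum.exhaust)
        then have i: "i \<in> R"
          using CW by (auto simp: W_def)
        define B where "B = {x. Inl (i, x) \<in> C}"
        have C: "C = Inl ` ({i} \<times> B)"
        proof
          show "C \<subseteq> Inl ` ({i} \<times> B)"
          proof
            fix u assume u: "u \<in> C"
            then obtain j y where jy: "u = Inl (j, y)"
              using False by (metis old.prod.exhaust sum.exhaust)
            have "j = i"
            proof (rule ccontr)
              assume "j \<noteq> i"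
              then show False
                using pairwiseD[OF cl u[unfolded jy] ix] by (auto simp: D_simps)
            qed
            then show "u \<in> Inl ` ({i} \<times> B)"
              using u jy by (auto simp: B_def)
          qed
        qed (auto simp: B_def)
        have "B \<subseteq> V i"
          using CW by (auto simp: B_def W_def)
        moreover have "pairwise (\<lambda>x y. d i x y \<noteq> None) B"
          using cl unfolding C by (auto simp: pairwise_def D_simps split: if_splits)
        ultimately obtain f where f: "inj_on f B" "f ` B \<subseteq> Q"
            "pairwise (\<lambda>x y. d i x y = Some (\<rho> {f x, f y})) B"
          using mod[OF i] unfolding modelled_on_def by meson
        show ?thesis
        proof (intro exI conjI)
          let ?f = "case_sum (\<lambda>(j :: 'c, x). f x) (undefined :: ('c \<Rightarrow> 'a set) \<Rightarrow> 'b)"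
          show "inj_on ?f C"
            using f unfolding C by (auto simp: inj_on_def)
          show "?f ` C \<subseteq> Q"
            using f unfolding C by auto
          show "pairwise (\<lambda>u v. D u v = Some (\<rho> {?f u, ?f v})) C"
            using f i unfolding C by (auto simp: pairwise_def D_simps)
        qed
      qed
    qed
  qed
  moreover have "vertex_arrows R a W D"
    unfolding vertex_arrows_def
  proof
    fix \<phi> assume \<phi>: "\<phi> \<in> W \<rightarrow> R"
    let ?goal = "\<exists>i\<in>R. \<exists>C\<in>[W]\<^bsup>a i\<^esup>. pairwise (\<lambda>u v. D u v \<noteq> None) C \<and> (\<forall>u\<in>C. \<phi> u = i)"
    have lift: "Inl ` ({i} \<times> C) \<in> [W]\<^bsup>n\<^esup> \<and> pairwise (\<lambda>u v. D u v \<noteq> None) (Inl ` ({i} \<times> C))"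
      if "i \<in> R" "C \<in> [V i]\<^bsup>n\<^esup>" "pairwise (\<lambda>x y. d i x y \<noteq> None) C" for i C n
      using that by (auto simp: nsets_def W_def pairwise_def D_simps card_image card_cartesian_product)
    show ?goal
    proof (cases "\<forall>i\<in>R. \<exists>C\<in>K i. \<forall>x\<in>C. \<phi> (Inl (i, x)) = i")
      \<comment> \<open>If no clique in \<open>K i\<close> has all its vertices coloured
        \<open>i\<close>, the lowered target of \<open>i\<close> is not met in \<open>V i\<close>,
        so some other colour \<open>j\<close> meets its full target there.\<close>
      case False
      then obtain i where i: "i \<in> R" and no: "\<not> (\<exists>C\<in>K i. \<forall>x\<in>C. \<phi> (Inl (i, x)) = i)"
        by blast
      have "(\<lambda>x. \<phi> (Inl (i, x))) \<in> V i \<rightarrow> R"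
        using \<phi> i by (auto simp: W_def)
      then obtain j C where j: "j \<in> R" and C: "C \<in> [V i]\<^bsup>(a(i := a i - 1)) j\<^esup>"
          and cl: "pairwise (\<lambda>x y. d i x y \<noteq> None) C" and mono: "\<forall>x\<in>C. \<phi> (Inl (i, x)) = j"
        using arr[OF i] unfolding vertex_arrows_def by (metis (no_types, lifting))
      have "j \<noteq> i"
        using no C cl mono by (auto simp: K_def)
      then have "C \<in> [V i]\<^bsup>a j\<^esup>"
        using C by simp
      then show ?goal
        using lift[OF i _ cl] j mono by (intro bexI[of _ j] bexI[of _ "Inl ` ({i} \<times> C)"]) auto
    next
      case True
      then obtain g where g: "\<And>i. i \<in> R \<Longrightarrow> g i \<in> K i" "\<And>i x. \<lbrakk>i \<in> R; x \<in> g i\<rbrakk> \<Longrightarrow> \<phi> (Inl (i, x)) = i"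
        by metis
      define h where "h = restrict g R"
      have hW: "Inr h \<in> W"
        using g by (auto simp: W_def h_def)
      define i where "i = \<phi> (Inr h)"
      have i: "i \<in> R"
        using \<phi> hW by (auto simp: i_def)
      have hi: "h i = g i"
        using i by (simp add: h_def)
      have gi: "g i \<in> [V i]\<^bsup>(a i - 1)\<^esup>" "pairwise (\<lambda>x y. d i x y \<noteq> None) (g i)"
        using g i by (auto simp: K_def)
      let ?C = "insert (Inr h) (Inl ` ({i} \<times> g i))"
      have "?C \<in> [W]\<^bsup>a i\<^esup>"
        using lift[OF i gi] hW a[OF i] by (auto simp: nsets_def card_insert_if)
      moreover have "pairwise (\<lambda>u v. D u v \<noteq> None) ?C"
        using lift[OF i gi] i hi by (auto simp: pairwise_insert D_simps N_def)
      moreover have "\<forall>u\<in>?C. \<phi> u = i"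
        using g(2)[OF i] by (auto simp: i_def)
      ultimately show ?goal
        using i by blast
    qed
  qed
  ultimately show ?thesis
    by blast
qed

text \<open>Induction on the sum of the targets. A target 0 is met by the empty clique, so the empty
  graph suffices. Otherwise lowering the target of each colour in turn provides the graphs
  \<open>V i\<close> for Zykov's construction.\<close>

lemma ex_vertex_arrows:
  fixes R :: "'c set" and Q :: "'b set" and A :: "nat set"
  assumes R: "finite R" "R \<noteq> {}" and Q: "finite Q" and "\<And>i. i \<in> R \<Longrightarrow> a i \<le> card Q" and A: "finite A"
  shows "\<exists>(V :: nat set) d. finite V \<and> V \<inter> A = {} \<and> modelled_on Q \<rho> V d \<and> vertex_arrows R a V d"
  using assms(4)
proof (induction "sum a R" arbitrary: a rule: less_induct)
  case less
  show ?case
  proof (cases "\<exists>i\<in>R. a i = 0")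
    case True
    have "modelled_on Q \<rho> ({} :: nat set) (\<lambda>_ _. None)" "vertex_arrows R a ({} :: nat set) (\<lambda>_ _. None)"
      using True by (force simp: modelled_on_def vertex_arrows_def nsets_empty_iff)+
    then show ?thesis
      by blast
  next
    case False
    have "\<exists>(V :: nat set) d. finite V \<and> modelled_on Q \<rho> V d \<and> vertex_arrows R (a(i := a i - 1)) V d"
      if i: "i \<in> R" for i
    proof -
      have "sum (a(i := a i - 1)) R < sum a R"
        using R i False by (intro sum_strict_mono_ex1) auto
      moreover have "(a(i := a i - 1)) j \<le> card Q" if "j \<in> R" for j
        using less.prems[OF that] by (auto intro: le_trans[OF diff_le_self])
      ultimately show ?thesis
        using less.hyps by blast
    qed
    then obtain V :: "'c \<Rightarrow> nat set" and d where Vd: "\<And>i. i \<in> R \<Longrightarrow> finite (V i)"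
        "\<And>i. i \<in> R \<Longrightarrow> modelled_on Q \<rho> (V i) (d i)"
        "\<And>i. i \<in> R \<Longrightarrow> vertex_arrows R (a(i := a i - 1)) (V i) (d i)"
      by metis
    have "\<exists>(W :: ('c \<times> nat + ('c \<Rightarrow> nat set)) set) D.
           finite W \<and> modelled_on Q \<rho> W D \<and> vertex_arrows R a W D"
      using False less.prems by (intro zykov_step[OF R Q _ Vd]) auto
    then obtain W :: "('c \<times> nat + ('c \<Rightarrow> nat set)) set" and D where
      W: "finite W" "modelled_on Q \<rho> W D" "vertex_arrows R a W D"
      by blast
    obtain h :: "('c \<times> nat + ('c \<Rightarrow> nat set)) \<Rightarrow> nat" where "inj_on h W" "h ` W \<inter> A = {}"
      using ex_inj_on_avoiding[OF W(1) A] by blast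
    then show ?thesis
      using modelled_arrows_image[OF _ W(2,3)] W(1) by (meson finite_imageI)
  qed
qed

lemma ex_vertex_Ramsey_graph:
  fixes R :: "'c set" and Q :: "'b set" and A :: "nat set" and \<rho> :: "'b set \<Rightarrow> nat"
  assumes R: "finite R" "R \<noteq> {}" and Q: "finite Q" and A: "finite A"
  obtains V :: "nat set" and E \<chi> where "finite V" "V \<inter> A = {}" "E \<subseteq> [V]\<^bsup>2\<^esup>"
    "\<And>C. \<lbrakk>C \<subseteq> V; clique C E\<rbrakk> \<Longrightarrow>
       \<exists>f. inj_on f C \<and> f ` C \<subseteq> Q \<and> (\<forall>x\<in>C. \<forall>y\<in>C. x \<noteq> y \<longrightarrow> \<chi> {x, y} = \<rho> {f x, f y})"
    "\<And>\<phi>. \<phi> \<in> V \<rightarrow> R \<Longrightarrow> \<exists>i\<in>R. \<exists>C\<in>[V]\<^bsup>(card Q)\<^esup>. clique C E \<and> (\<forall>x\<in>C. \<phi> x = i)"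
proof -
  obtain V :: "nat set" and d where V: "finite V" "V \<inter> A = {}"
      and mod: "modelled_on Q \<rho> V d" and arr: "vertex_arrows R (\<lambda>_. card Q) V d"
    using ex_vertex_arrows[OF R Q _ A, of "\<lambda>_. card Q" \<rho>] by auto
  define E where "E = {{x, y} |x y. x \<in> V \<and> y \<in> V \<and> x \<noteq> y \<and> d x y \<noteq> None}"
  \<comment> \<open>\<open>Min\<close> and \<open>Max\<close> recover the ends of an unordered edge;
    by symmetry of \<open>d\<close> their order does not matter.\<close>
  define \<chi> where "\<chi> e = the (d (Min e) (Max e))" for e
  have sym: "d x y = d y x" for x y
    using mod by (simp add: modelled_on_def)
  have \<chi>: "\<chi> {x, y} = the (d x y)" for x y
    using sym by (cases "x \<le> y") (simp_all add: \<chi>_def min_def max_def)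
  have E: "{x, y} \<in> E \<longleftrightarrow> x \<in> V \<and> y \<in> V \<and> x \<noteq> y \<and> d x y \<noteq> None" for x y
    using sym by (auto simp: E_def doubleton_eq_iff)
  have clique_E: "clique C E \<longleftrightarrow> pairwise (\<lambda>x y. d x y \<noteq> None) C" if "C \<subseteq> V" for C
    using that by (auto simp: clique_def pairwise_def E)
  show ?thesis
  proof (rule that[OF V])
    show "E \<subseteq> [V]\<^bsup>2\<^esup>"
      by (auto simp: E_def)
    show "\<exists>f. inj_on f C \<and> f ` C \<subseteq> Q \<and> (\<forall>x\<in>C. \<forall>y\<in>C. x \<noteq> y \<longrightarrow> \<chi> {x, y} = \<rho> {f x, f y})"
      if C: "C \<subseteq> V" "clique C E" for C
    proof -
      obtain f where "inj_on f C" "f ` C \<subseteq> Q" "pairwise (\<lambda>x y. d x y = Some (\<rho> {f x, f y})) C"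
        using mod C clique_E unfolding modelled_on_def by meson
      then show ?thesis
        by (intro exI[of _ f]) (auto simp: pairwise_def \<chi>)
    qed
    show "\<exists>i\<in>R. \<exists>C\<in>[V]\<^bsup>(card Q)\<^esup>. clique C E \<and> (\<forall>x\<in>C. \<phi> x = i)" if "\<phi> \<in> V \<rightarrow> R" for \<phi>
    proof -
      obtain i C where "i \<in> R" "C \<in> [V]\<^bsup>(card Q)\<^esup>" "pairwise (\<lambda>x y. d x y \<noteq> None) C" "\<forall>x\<in>C. \<phi> x = i"
        using arr \<open>\<phi> \<in> V \<rightarrow> R\<close> unfolding vertex_arrows_def by meson
      then show ?thesis
        using clique_E by (auto simp: nsets_def)
    qed
  qed
qed

subsection \<open>Adding a colour\<close>

text \<open>The palette is a set \<open>I\<close> rather than a number because the inductive step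
  takes one colour out of it.\<close>

definition arrows_clique :: "nat set \<Rightarrow> nat \<Rightarrow> 'a set \<Rightarrow> 'a set set \<Rightarrow> bool" where
  "arrows_clique I k V E \<longleftrightarrow>
     (\<forall>c\<in>E \<rightarrow> I. \<exists>i\<in>I. \<exists>C\<in>[V]\<^bsup>k\<^esup>. clique C (colour_class E c i))"

definition isolating_colouring :: "nat set \<Rightarrow> nat \<Rightarrow> 'a set \<Rightarrow> 'a set set \<Rightarrow> ('a set \<Rightarrow> nat) \<Rightarrow> bool" where
  "isolating_colouring I k V E c \<longleftrightarrow> c \<in> E \<rightarrow> I \<and>
     (\<forall>i\<in>I. \<forall>C\<in>[V]\<^bsup>k\<^esup>. clique C (colour_class E c i) \<longrightarrow>
        (\<forall>x\<in>C. \<forall>y\<in>V - C. {x, y} \<notin> colour_class E c i))"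

lemma arrows_clique_recolour:
  assumes h: "bij_betw h I J" and arr: "arrows_clique J k V E"
  shows "arrows_clique I k V E"
  unfolding arrows_clique_def
proof
  fix c assume c: "c \<in> E \<rightarrow> I"
  then have "h \<circ> c \<in> E \<rightarrow> J"
    using h by (auto simp: bij_betw_def)
  then obtain j C where j: "j \<in> J" and C: "C \<in> [V]\<^bsup>k\<^esup>" "clique C (colour_class E (h \<circ> c) j)"
    using arr unfolding arrows_clique_def by metis
  obtain i where i: "i \<in> I" "j = h i"
    using h j by (auto simp: bij_betw_def)
  have "colour_class E (h \<circ> c) j \<subseteq> colour_class E c i"
    using h c i by (auto simp: colour_class_def bij_betw_def inj_on_def Pi_iff)
  then show "\<exists>i\<in>I. \<exists>C\<in>[V]\<^bsup>k\<^esup>. clique C (colour_class E c i)"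
    using i C by (metis clique_def subsetD)
qed

lemma isolating_colouring_recolour:
  assumes h: "bij_betw h J I" and c: "isolating_colouring J k V E c"
  shows "isolating_colouring I k V E (h \<circ> c)"
  unfolding isolating_colouring_def
proof (intro conjI ballI impI)
  have cE: "c \<in> E \<rightarrow> J"
    using c by (simp add: isolating_colouring_def)
  then show "h \<circ> c \<in> E \<rightarrow> I"
    using h by (auto simp: bij_betw_def)
  fix i C x y assume i: "i \<in> I" and C: "C \<in> [V]\<^bsup>k\<^esup>" "clique C (colour_class E (h \<circ> c) i)"
    and xy: "x \<in> C" "y \<in> V - C"
  obtain j where j: "j \<in> J" "i = h j"
    using h i by (auto simp: bij_betw_def)
  have "colour_class E (h \<circ> c) i = colour_class E c j"
    using h cE j by (auto simp: colour_class_def bij_betw_def inj_on_def Pi_iff)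
  then show "{x, y} \<notin> colour_class E (h \<circ> c) i"
    using c j C xy unfolding isolating_colouring_def by metis
qed

text \<open>
  Every edge between the old graph on \<open>V\<close> and the new graph on \<open>X\<close> gets the colour \<open>j\<close> in
  which the critical colouring has no \<open>K_(k-1)\<close>; the colours on \<open>V\<close> are renamed to avoid \<open>j\<close>.
  For the Ramsey property, a vertex of \<open>X\<close> is coloured by the vector of colours of its edges
  to \<open>V\<close>.
\<close>

lemma isolating_step:
  fixes V :: "nat set"
  assumes k: "k \<ge> 3" and q: "q > 0" and V: "finite V" "E \<subseteq> [V]\<^bsup>2\<^esup>"
    and arr: "arrows_clique {..<q} k V E" and iso: "isolating_colouring {..<q} k V E c"
  obtains W :: "nat set" and F c' where "finite W" "F \<subseteq> [W]\<^bsup>2\<^esup>"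
    "arrows_clique {..<Suc q} k W F" "isolating_colouring {..<Suc q} k W F c'"
proof -
  obtain j \<rho> and Q :: "nat set" where j: "j < Suc q" and Q: "finite Q" and \<rho>: "critical_colouring (Suc q) k j Q \<rho>"
    and max: "\<And>j' (Q' :: nat set) \<rho>'. \<lbrakk>j' < Suc q; finite Q'; critical_colouring (Suc q) k j' Q' \<rho>'\<rbrakk> \<Longrightarrow> card Q' \<le> card Q"
    by (rule ex_maximal_critical_colouring[OF zero_less_Suc[of q] k]) (rule that)
  \<comment> \<open>The possible vectors of colours on \<open>V\<close>; as extensional functions
    they form a finite set.\<close>
  define R where "R = V \<rightarrow>\<^sub>E {..<Suc q}"
  have R: "finite R" "R \<noteq> {}"
    using V by (auto simp: R_def finite_PiE PiE_eq_empty_iff)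
  obtain X :: "nat set" and T \<chi> where X: "finite X" "X \<inter> V = {}" "T \<subseteq> [X]\<^bsup>2\<^esup>"
    and model: "\<And>C. \<lbrakk>C \<subseteq> X; clique C T\<rbrakk> \<Longrightarrow>
       \<exists>f. inj_on f C \<and> f ` C \<subseteq> Q \<and> (\<forall>x\<in>C. \<forall>y\<in>C. x \<noteq> y \<longrightarrow> \<chi> {x, y} = \<rho> {f x, f y})"
    and vR: "\<And>\<phi>. \<phi> \<in> X \<rightarrow> R \<Longrightarrow> \<exists>g\<in>R. \<exists>C\<in>[X]\<^bsup>(card Q)\<^esup>. clique C T \<and> (\<forall>x\<in>C. \<phi> x = g)"
    by (rule ex_vertex_Ramsey_graph[OF R Q V(1), where \<rho> = \<rho>]) (rule that)
  define W where "W = V \<union> X"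
  define F where "F = E \<union> T \<union> {{a, x} |a x. a \<in> V \<and> x \<in> X}"
  have E_iff: "{x, y} \<in> E \<Longrightarrow> x \<in> V \<and> y \<in> V \<and> x \<noteq> y" and T_iff: "{x, y} \<in> T \<Longrightarrow> x \<in> X \<and> y \<in> X \<and> x \<noteq> y" for x y
    using subsetD[OF V(2), of "{x, y}"] subsetD[OF X(3), of "{x, y}"] by simp_all
  have disj: "x \<notin> V" if "x \<in> X" for x
    using X(2) that by blast
  have F_VX: "{a, x} \<in> F" if "a \<in> V" "x \<in> X" for a x
    using that by (auto simp: F_def)
  have F_VV: "{x, y} \<in> F \<longleftrightarrow> {x, y} \<in> E" if "x \<in> V" "y \<in> V" for x y
    using that disj T_iff by (auto simp: F_def doubleton_eq_iff)
  have F_XX: "{x, y} \<in> F \<longleftrightarrow> {x, y} \<in> T" if "x \<in> X" "y \<in> X" for x y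
    using that disj E_iff by (auto simp: F_def doubleton_eq_iff)
  have "finite W"
    using V X by (simp add: W_def)
  moreover have "F \<subseteq> [W]\<^bsup>2\<^esup>"
    using V(2) X disj nsets_mono[of V W 2] nsets_mono[of X W 2] by (auto simp: F_def W_def)
  moreover have "arrows_clique {..<Suc q} k W F"
    unfolding arrows_clique_def
  proof (rule ballI, rule ccontr)
    fix \<psi> assume \<psi>: "\<psi> \<in> F \<rightarrow> {..<Suc q}"
      and "\<not> (\<exists>i\<in>{..<Suc q}. \<exists>C\<in>[W]\<^bsup>k\<^esup>. clique C (colour_class F \<psi> i))"
    then have no_mono: "False" if "i < Suc q" "C \<in> [W]\<^bsup>k\<^esup>" "clique C (colour_class F \<psi> i)" for i C
      using that by blast
    define \<phi> where "\<phi> x = (\<lambda>a\<in>V. \<psi> {a, x})" for x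
    have "\<phi> \<in> X \<rightarrow> R"
      using \<psi> F_VX by (auto simp: \<phi>_def R_def)
    then obtain g C where g: "g \<in> R" and C: "C \<in> [X]\<^bsup>(card Q)\<^esup>" "clique C T" and \<phi>C: "\<forall>x\<in>C. \<phi> x = g"
      using vR by metis
    have CX: "C \<subseteq> X" "finite C" "card C = card Q"
      using C by (auto simp: nsets_def)
    have cross: "\<psi> {a, x} = g a" if "a \<in> V" "x \<in> C" for a x
      using \<phi>C that by (metis \<phi>_def restrict_apply')
    have C_T: "{x, y} \<in> T" if "x \<in> C" "y \<in> C" "x \<noteq> y" for x y
      using C(2) that by (simp add: clique_def)
    have g_less: "g a < Suc q" if "a \<in> V" for a
      using g that by (auto simp: R_def)
    have \<psi>C: "\<psi> \<in> [C]\<^bsup>2\<^esup> \<rightarrow> {..<Suc q}"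
    proof
      fix e assume "e \<in> [C]\<^bsup>2\<^esup>"
      then have "e \<in> F"
        using C_T by (auto simp: F_def elim!: nsets2_E)
      then show "\<psi> e \<in> {..<Suc q}"
        using \<psi> by blast
    qed
    have clique_F: "D \<in> [W]\<^bsup>n\<^esup> \<and> clique D (colour_class F \<psi> i)"
      if "D \<in> [C]\<^bsup>n\<^esup>" "clique D (colour_class UNIV \<psi> i)" for D n i
    proof
      have "D \<subseteq> C"
        using that by (simp add: nsets_def)
      then show "D \<in> [W]\<^bsup>n\<^esup>"
        using that CX by (auto simp: nsets_def W_def)
      show "clique D (colour_class F \<psi> i)"
        using that(2) \<open>D \<subseteq> C\<close> C_T by (auto simp: clique_def colour_class_def F_def subset_iff)
    qed
    have free: "\<not> clique D (colour_class UNIV \<psi> i)" if "i < Suc q" "D \<in> [C]\<^bsup>k\<^esup>" for i D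
      using no_mono clique_F that by blast
    \<comment> \<open>\<open>\<psi>\<close> on \<open>C\<close> need not agree with
      \<open>\<rho>\<close> on \<open>Q\<close>, but \<open>C\<close> has as many vertices as
      \<open>Q\<close>. Joining one more vertex to \<open>C\<close> in colour \<open>i\<close> would
      thus give a critical colouring, with distinguished colour \<open>l\<close>, that is larger
      than the maximum.\<close>
    have not_critical: False if "i < Suc q" "l < Suc q"
      "\<And>D. D \<in> [C]\<^bsup>(k - 1)\<^esup> \<Longrightarrow> \<not> clique D (colour_class UNIV \<psi> i)"
      "\<And>D. D \<in> [C]\<^bsup>(if l = i then k - 2 else k - 1)\<^esup> \<Longrightarrow> \<not> clique D (colour_class UNIV \<psi> l)" for i l
    proof -
      obtain v where "v \<notin> C"
        using CX(2) ex_new_if_finite infinite_UNIV_nat by blast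
      then have "critical_colouring (Suc q) k l (insert v C) (\<lambda>e. if v \<in> e then i else \<psi> e)"
        using critical_colouring_insert[OF _ \<open>i < Suc q\<close> k \<psi>C free that(3,4)] by blast
      then have "card (insert v C) \<le> card Q"
        using max that CX by blast
      then show False
        using CX \<open>v \<notin> C\<close> by simp
    qed
    \<comment> \<open>Together with \<open>a\<close>, such a \<open>D\<close> would be a clique of
      size \<open>k\<close> in colour \<open>g a\<close>.\<close>
    have g_free: "\<not> clique D (colour_class UNIV \<psi> (g a))" if a: "a \<in> V" and D: "D \<in> [C]\<^bsup>(k - 1)\<^esup>" for a D
    proof
      assume cl: "clique D (colour_class UNIV \<psi> (g a))"
      have DC: "D \<subseteq> C" "finite D" "card D = k - 1"
        using D by (auto simp: nsets_def)
      then have "a \<notin> D"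
        using a CX disj by blast
      then have "insert a D \<in> [W]\<^bsup>k\<^esup>"
        using DC a k CX by (auto simp: nsets_def W_def)
      moreover have "clique (insert a D) (colour_class F \<psi> (g a))"
        using clique_F[OF D cl] DC CX a cross F_VX
        by (auto simp: clique_insert colour_class_def subset_iff)
      ultimately show False
        using no_mono g_less[OF a] by blast
    qed
    \<comment> \<open>A constant colouring, available since \<open>q > 0\<close>, forces a clique of
      size \<open>k\<close> in \<open>V\<close>.\<close>
    have "V \<noteq> {}"
    proof -
      have "(\<lambda>_. 0) \<in> E \<rightarrow> {..<q}"
        using q by simp
      then obtain D where "D \<in> [V]\<^bsup>k\<^esup>"
        using arr unfolding arrows_clique_def by metis
      then show ?thesis
        using k by (auto simp: nsets_def)
    qed
    then obtain b where b: "b \<in> V"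
      by blast
    \<comment> \<open>Otherwise \<open>g a\<close> and \<open>g b\<close> are two colours without a
      clique of size \<open>k - 1\<close> in \<open>C\<close>, which \<open>not_critical\<close>
      rules out.\<close>
    have g_const: "g a = g b" if "a \<in> V" for a
    proof (rule ccontr)
      assume "g a \<noteq> g b"
      then show False
        using not_critical[of "g b" "g a"] g_free g_less b that by simp
    qed
    \<comment> \<open>The case \<open>i = l\<close> of \<open>not_critical\<close> yields a clique
      of size \<open>k - 2\<close> in colour \<open>g b\<close> inside \<open>C\<close>. The two
      ends of \<open>e\<close> would complete it to size \<open>k\<close>.\<close>
    have "\<psi> e \<noteq> g b" if "e \<in> E" for e
    proof
      assume eb: "\<psi> e = g b"
      have "e \<in> [V]\<^bsup>2\<^esup>"
        using \<open>e \<in> E\<close> V(2) by blast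
      then obtain x y where xy: "e = {x, y}" "x \<in> V" "y \<in> V" "x \<noteq> y"
        by (rule nsets2_E)
      obtain D where D: "D \<in> [C]\<^bsup>(k - 2)\<^esup>" "clique D (colour_class UNIV \<psi> (g b))"
        using not_critical[of "g b" "g b"] g_free[OF b] g_less[OF b] by auto
      have DC: "D \<subseteq> C" "finite D" "card D = k - 2"
        using D(1) by (auto simp: nsets_def)
      then have "x \<notin> D" "y \<notin> D"
        using xy CX disj by blast+
      then have "insert x (insert y D) \<in> [W]\<^bsup>k\<^esup>"
        using DC xy k CX by (auto simp: nsets_def W_def)
      moreover have "clique (insert x (insert y D)) (colour_class F \<psi> (g b))"
        using clique_F[OF D] DC CX xy cross g_const F_VX eb \<open>e \<in> E\<close> F_VV[of x y]
        by (auto simp: clique_insert colour_class_def subset_iff)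
      ultimately show False
        using no_mono g_less[OF b] by blast
    qed
    then have "\<psi> \<in> E \<rightarrow> {..<Suc q} - {g b}"
      using \<psi> by (auto simp: F_def Pi_iff)
    moreover have "card ({..<Suc q} - {g b}) = card {..<q}"
      using g_less[OF b] by simp
    then obtain h where "bij_betw h ({..<Suc q} - {g b}) {..<q}"
      using finite_same_card_bij by (metis finite_Diff finite_lessThan)
    then have "arrows_clique ({..<Suc q} - {g b}) k V E"
      using arr by (rule arrows_clique_recolour)
    ultimately obtain i D where i: "i < Suc q" and D: "D \<in> [V]\<^bsup>k\<^esup>" "clique D (colour_class E \<psi> i)"
      unfolding arrows_clique_def by blast
    have "D \<in> [W]\<^bsup>k\<^esup>"
      using D by (auto simp: nsets_def W_def)
    moreover have "clique D (colour_class F \<psi> i)"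
      using D(2) by (auto simp: clique_def colour_class_def F_def)
    ultimately show False
      using no_mono i by blast
  qed
  moreover have "\<exists>c'. isolating_colouring {..<Suc q} k W F c'"
  proof -
    have "card {..<q} = card ({..<Suc q} - {j})"
      using j by simp
    then obtain h where "bij_betw h {..<q} ({..<Suc q} - {j})"
      using finite_same_card_bij by (metis finite_Diff finite_lessThan)
    then have iso': "isolating_colouring ({..<Suc q} - {j}) k V E (h \<circ> c)"
      using iso by (rule isolating_colouring_recolour)
    \<comment> \<open>The default \<open>j\<close> is the colour of the joining edges.\<close>
    define c' where "c' e = (if e \<in> E then (h \<circ> c) e else if e \<in> T then \<chi> e else j)" for e
    have hc: "(h \<circ> c) e \<in> {..<Suc q} - {j}" if "e \<in> E" for e
      using iso' that unfolding isolating_colouring_def by blast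
    have T_E: "e \<notin> E" if "e \<in> T" for e
    proof -
      have "e \<in> [X]\<^bsup>2\<^esup>"
        using that X(3) by blast
      then obtain x y where "e = {x, y}" "x \<in> X" "y \<in> X" "x \<noteq> y"
        by (rule nsets2_E)
      then show ?thesis
        using E_iff disj by blast
    qed
    have c'_E: "c' e = (h \<circ> c) e" if "e \<in> E" for e
      using that by (simp add: c'_def)
    have c'_T: "c' e = \<chi> e" if "e \<in> T" for e
      using that T_E by (simp add: c'_def)
    have c'_VX: "c' {a, x} = j" if "a \<in> V" "x \<in> X" for a x
      using that disj E_iff[of a x] T_iff[of a x] by (auto simp: c'_def)
    have \<chi>_less: "\<chi> e < Suc q" if "e \<in> T" for e
    proof -
      have "e \<in> [X]\<^bsup>2\<^esup>"
        using that X(3) by blast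
      then obtain x y where xy: "e = {x, y}" "x \<in> X" "y \<in> X" "x \<noteq> y"
        by (rule nsets2_E)
      \<comment> \<open>The model speaks of cliques only, so a single edge is treated as a clique of
        size 2.\<close>
      have "clique {x, y} T"
        using that xy by (auto simp: clique_def insert_commute)
      then obtain f where f: "inj_on f {x, y}" "f ` {x, y} \<subseteq> Q" "\<chi> {x, y} = \<rho> {f x, f y}"
        using model[of "{x, y}"] xy by auto
      have "{f x, f y} \<in> [Q]\<^bsup>2\<^esup>"
        using f(1,2) xy by auto
      then show ?thesis
        using \<rho> f xy unfolding critical_colouring_def by (metis PiE lessThan_iff)
    qed
    \<comment> \<open>A monochromatic clique inside \<open>X\<close> is carried by the model to one
      of the same size and colour in \<open>Q\<close>, where \<open>\<rho>\<close> restricts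
      it.\<close>
    have T_clique: "\<exists>D\<in>[Q]\<^bsup>n\<^esup>. clique D (colour_class UNIV \<rho> i)"
      if "C \<in> [X]\<^bsup>n\<^esup>" "clique C (colour_class F c' i)" for C n i
    proof -
      have CX: "C \<subseteq> X"
        using that by (simp add: nsets_def)
      have CE: "{x, y} \<in> T" "\<chi> {x, y} = i" if "x \<in> C" "y \<in> C" "x \<noteq> y" for x y
      proof -
        have "{x, y} \<in> F" and col: "c' {x, y} = i" and "x \<in> X" "y \<in> X"
          using \<open>clique C _\<close> that CX by (auto simp: clique_def colour_class_def)
        then show "{x, y} \<in> T"
          using F_XX by blast
        then show "\<chi> {x, y} = i"
          using c'_T col by simp
      qed
      then have "clique C T"
        by (auto simp: clique_def)
      then obtain f where f: "inj_on f C" "f ` C \<subseteq> Q" "\<forall>x\<in>C. \<forall>y\<in>C. x \<noteq> y \<longrightarrow> \<chi> {x, y} = \<rho> {f x, f y}"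
        using model CX by blast
      have "f ` C \<in> [Q]\<^bsup>n\<^esup>"
        using f that(1) by (auto simp: nsets_def card_image)
      moreover have "clique (f ` C) (colour_class UNIV \<rho> i)"
        using f(3) CE by (auto simp: clique_def colour_class_def)
      ultimately show ?thesis
        by blast
    qed
    have "isolating_colouring {..<Suc q} k W F c'"
      unfolding isolating_colouring_def
    proof (intro conjI ballI impI)
      show "c' \<in> F \<rightarrow> {..<Suc q}"
        using hc \<chi>_less j c'_E c'_T by (auto simp: F_def c'_VX)
      fix i C x y
      assume i: "i \<in> {..<Suc q}" and C: "C \<in> [W]\<^bsup>k\<^esup>" and cl: "clique C (colour_class F c' i)"
        and x: "x \<in> C" and y: "y \<in> W - C"
      have CW: "C \<subseteq> W" "finite C" "card C = k"
        using C by (auto simp: nsets_def)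
      have C_col: "c' {u, v} = i" "{u, v} \<in> F" if "u \<in> C" "v \<in> C" "u \<noteq> v" for u v
        using cl that by (auto simp: clique_def colour_class_def)
      have no_X: "\<not> C \<subseteq> X"
      proof
        assume "C \<subseteq> X"
        then have "C \<in> [X]\<^bsup>k\<^esup>"
          using CW by (simp add: nsets_def)
        then show False
          using T_clique[OF _ cl] \<rho> i unfolding critical_colouring_def by blast
      qed
      \<comment> \<open>Colour \<open>j\<close> does not occur on \<open>E\<close>, so a clique of
        colour \<open>j\<close> has at most one vertex in \<open>V\<close>. The others would form a
        clique of size \<open>k - 1\<close> in colour \<open>j\<close> inside
        \<open>X\<close>.\<close>
      have "i \<noteq> j"
      proof
        assume "i = j"
        obtain a where a: "a \<in> C" "a \<in> V"
          using no_X CW by (auto simp: W_def)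
        have "C - {a} \<subseteq> X"
        proof
          fix u assume u: "u \<in> C - {a}"
          show "u \<in> X"
          proof (rule ccontr)
            assume "u \<notin> X"
            then have "u \<in> V"
              using u CW by (auto simp: W_def)
            then have "{a, u} \<in> E"
              using C_col(2)[of a u] a u F_VV by auto
            then show False
              using hc c'_E C_col(1)[of a u] a u \<open>i = j\<close> by auto
          qed
        qed
        then have "C - {a} \<in> [X]\<^bsup>(k - 1)\<^esup>"
          using CW a by (auto simp: nsets_def)
        moreover have "clique (C - {a}) (colour_class F c' j)"
          using cl \<open>i = j\<close> smaller_clique by blast
        ultimately show False
          using T_clique \<rho> unfolding critical_colouring_def by blast
      qed
      \<comment> \<open>A clique meeting both \<open>V\<close> and \<open>X\<close> contains a
        joining edge and so has colour \<open>j\<close>.\<close>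
      have CV: "C \<subseteq> V"
      proof (rule ccontr)
        assume "\<not> C \<subseteq> V"
        then obtain a u where "a \<in> C" "a \<in> V" "u \<in> C" "u \<in> X"
          using no_X CW by (auto simp: W_def)
        then show False
          using C_col(1)[of a u] c'_VX disj \<open>i \<noteq> j\<close> by auto
      qed
      have in_V: "{u, v} \<in> colour_class E (h \<circ> c) i" if "{u, v} \<in> colour_class F c' i" "u \<in> V" "v \<in> V" for u v
        using that F_VV c'_E by (auto simp: colour_class_def)
      have "clique C (colour_class E (h \<circ> c) i)"
        using cl CV in_V by (auto simp: clique_def subset_iff)
      moreover have "C \<in> [V]\<^bsup>k\<^esup>"
        using CW CV by (simp add: nsets_def)
      ultimately have "{x, y} \<notin> colour_class E (h \<circ> c) i" if "y \<in> V"
        using iso' i \<open>i \<noteq> j\<close> x y that unfolding isolating_colouring_def by blast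
      moreover have "{x, y} \<notin> colour_class F c' i" if "y \<in> X"
        using c'_VX[of x y] x CV that \<open>i \<noteq> j\<close> by (auto simp: colour_class_def)
      ultimately show "{x, y} \<notin> colour_class F c' i"
        using in_V x y CV by (auto simp: W_def)
    qed
    then show ?thesis
      by blast
  qed
  ultimately show ?thesis
    using that by blast
qed

lemma ex_arrows_clique_isolating:
  assumes k: "k \<ge> 3" and q: "q > 0"
  shows "\<exists>(V :: nat set) E c. finite V \<and> E \<subseteq> [V]\<^bsup>2\<^esup> \<and>
    arrows_clique {..<q} k V E \<and> isolating_colouring {..<q} k V E c"
  using q
proof (induction q rule: nat_induct_non_zero)
  case 1
  have mono: "clique {..<k} (colour_class ([{..<k}]\<^bsup>2\<^esup>) c 0)" if "c \<in> [{..<k}]\<^bsup>2\<^esup> \<rightarrow> {..<1}" for c :: "nat set \<Rightarrow> nat"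
    using that by (auto simp: clique_def colour_class_def Pi_iff)
  have "arrows_clique {..<1} k {..<k} ([{..<k}]\<^bsup>2\<^esup>)"
    using mono by (auto simp: arrows_clique_def)
  moreover have "isolating_colouring {..<1} k {..<k} ([{..<k}]\<^bsup>2\<^esup>) (\<lambda>_. 0)"
    by (auto simp: isolating_colouring_def)
  ultimately show ?case
    by blast
next
  case (Suc n)
  then obtain V :: "nat set" and E c where "finite V" "E \<subseteq> [V]\<^bsup>2\<^esup>"
      "arrows_clique {..<n} k V E" "isolating_colouring {..<n} k V E c"
    by blast
  then show ?case
    using isolating_step[OF k \<open>n > 0\<close>] by metis
qed

subsection \<open>Minimal Ramsey graphs\<close>

lemma q_Ramsey_complete_graph:
  assumes k: "k \<ge> 2" and arr: "arrows_clique {..<q} k V E"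
  shows "q_Ramsey q (complete_graph k) (V, E)"
  unfolding q_Ramsey_def
proof (intro allI impI)
  fix c assume "edge_colouring q (V, E) c"
  then obtain i C where i: "i < q" and C: "C \<in> [V]\<^bsup>k\<^esup>" and cl: "clique C (colour_class E c i)"
    using arr unfolding arrows_clique_def edge_colouring_def by (metis lessThan_iff snd_conv)
  have C': "C \<subseteq> V" "finite C" "card C = k"
    using C by (auto simp: nsets_def)
  then obtain f where f: "bij_betw f {..<k} C"
    by (metis ex_bij_betw_nat_finite lessThan_atLeast0)
  have mono: "e \<in> E \<and> c e = i" if "e \<in> [C]\<^bsup>2\<^esup>" for e
    using that cl by (auto simp: clique_def colour_class_def elim!: nsets2_E)
  have "subgraph_of (C, [C]\<^bsup>2\<^esup>) (V, E)"
    using C' mono by (auto simp: subgraph_of_def finite_simple_graph_def)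
  moreover have "graph_iso (complete_graph k) (C, [C]\<^bsup>2\<^esup>)"
    unfolding graph_iso_def complete_graph_def using f
    by (intro exI[of _ f]) (auto simp: bij_betw_def inj_on_def)
  ultimately show "has_mono_copy q (complete_graph k) (V, E) c"
    unfolding has_mono_copy_def using i mono by auto
qed

text \<open>In a monochromatic copy, the image of the pendant edge \<open>{0, k}\<close> would leave
  a clique of size \<open>k\<close> in the colour of that clique.\<close>

lemma not_q_Ramsey_complete_graph_pendant:
  assumes k: "k \<ge> 2" and iso: "isolating_colouring {..<q} k V E c"
  shows "\<not> q_Ramsey q (complete_graph_pendant k) (V, E)"
proof
  assume "q_Ramsey q (complete_graph_pendant k) (V, E)"
  moreover have "edge_colouring q (V, E) c"
    using iso by (simp add: isolating_colouring_def edge_colouring_def)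
  ultimately obtain H i where H: "subgraph_of H (V, E)" "graph_iso (complete_graph_pendant k) H"
      and i: "i < q" and mono: "\<forall>e\<in>edges H. c e = i"
    unfolding q_Ramsey_def has_mono_copy_def by blast
  obtain f where f: "bij_betw f {..k} (verts H)"
      and edge: "\<And>u v. \<lbrakk>u \<le> k; v \<le> k; {u, v} \<in> edges (complete_graph_pendant k)\<rbrakk> \<Longrightarrow> {f u, f v} \<in> edges H"
    using H(2) unfolding graph_iso_def
    by (auto simp: complete_graph_pendant_def complete_graph_def lessThan_Suc[symmetric] lessThan_Suc_atMost)
  have in_class: "{f u, f v} \<in> colour_class E c i"
    if "u \<le> k" "v \<le> k" "{u, v} \<in> edges (complete_graph_pendant k)" for u v
    using edge[OF that] H(1) mono by (auto simp: colour_class_def subgraph_of_def)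
  have inj: "inj_on f {..k}" and fV: "f ` {..k} \<subseteq> V"
    using f H(1) by (auto simp: bij_betw_def subgraph_of_def)
  let ?C = "f ` {..<k}"
  have "inj_on f {..<k}"
    using inj by (rule inj_on_subset) auto
  then have "?C \<in> [V]\<^bsup>k\<^esup>"
    using fV by (auto simp: nsets_def card_image)
  moreover have "{f u, f v} \<in> colour_class E c i" if "u < k" "v < k" "u \<noteq> v" for u v
    using that by (intro in_class) (auto simp: complete_graph_pendant_def complete_graph_def)
  then have "clique ?C (colour_class E c i)"
    by (auto simp: clique_def)
  moreover have "f k \<noteq> f u" if "u < k" for u
    using inj_onD[OF inj, of k u] that by auto
  then have "f 0 \<in> ?C" "f k \<in> V - ?C"
    using fV k by auto
  ultimately have "{f 0, f k} \<notin> colour_class E c i"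
    using iso i unfolding isolating_colouring_def by blast
  then show False
    using in_class[of 0 k] by (simp add: complete_graph_pendant_def)
qed

lemma subgraph_of_trans: "subgraph_of G'' G' \<Longrightarrow> subgraph_of G' G \<Longrightarrow> subgraph_of G'' G"
  by (auto simp: subgraph_of_def)

lemma q_Ramsey_mono:
  assumes "subgraph_of G' G" "q_Ramsey q H G'"
  shows "q_Ramsey q H G"
  unfolding q_Ramsey_def
proof (intro allI impI)
  fix c assume "edge_colouring q G c"
  then have "edge_colouring q G' c"
    using assms(1) by (auto simp: edge_colouring_def subgraph_of_def)
  then have "has_mono_copy q H G' c"
    using assms(2) by (simp add: q_Ramsey_def)
  then show "has_mono_copy q H G c"
    unfolding has_mono_copy_def using assms(1) subgraph_of_trans by blast
qed

text \<open>Descent on the number of vertices plus edges: a proper subgraph may differ only by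
  isolated vertices, so counting edges alone would not do.\<close>

lemma ex_q_Ramsey_minimal_subgraph:
  assumes "finite_simple_graph G" "q_Ramsey q H G"
  shows "\<exists>G'. subgraph_of G' G \<and> q_Ramsey_minimal q H G'"
  using assms
proof (induction "card (verts G) + card (edges G)" arbitrary: G rule: less_induct)
  case less
  show ?case
  proof (cases "\<exists>G'. subgraph_of G' G \<and> G' \<noteq> G \<and> q_Ramsey q H G'")
    case False
    then have "q_Ramsey_minimal q H G"
      using less.prems(2) unfolding q_Ramsey_minimal_def by blast
    moreover have "subgraph_of G G"
      using less.prems(1) by (simp add: subgraph_of_def)
    ultimately show ?thesis
      by blast
  next
    case True
    then obtain G' where G': "subgraph_of G' G" "G' \<noteq> G" "q_Ramsey q H G'"
      by blast
    have fin: "finite (verts G)" "finite (edges G)"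
      using less.prems(1) finite_subset[OF _ finite_imp_finite_nsets]
      by (auto simp: finite_simple_graph_def)
    have sub: "verts G' \<subseteq> verts G" "edges G' \<subseteq> edges G" "finite_simple_graph G'"
      using G' by (auto simp: subgraph_of_def)
    have "verts G' \<subset> verts G \<or> edges G' \<subset> edges G"
      using G'(2) sub by (auto simp: prod_eq_iff)
    then have "card (verts G') + card (edges G') < card (verts G) + card (edges G)"
      using sub fin by (meson add_le_less_mono add_less_le_mono card_mono psubset_card_mono)
    then obtain G'' where "subgraph_of G'' G'" "q_Ramsey_minimal q H G''"
      using less.hyps sub G' by blast
    then show ?thesis
      using G'(1) subgraph_of_trans by blast
  qed
qed

theorem theorem1p9:
  fixes k q :: nat
  assumes "k \<ge> 3" and "q \<ge> 3"
  shows "\<not> q_equivalent q (complete_graph k) (complete_graph_pendant k)"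
proof
  assume eq: "q_equivalent q (complete_graph k) (complete_graph_pendant k)"
  obtain V :: "nat set" and E c where G: "finite V" "E \<subseteq> [V]\<^bsup>2\<^esup>"
      "arrows_clique {..<q} k V E" "isolating_colouring {..<q} k V E c"
    using ex_arrows_clique_isolating[of k q] assms by auto
  have "finite_simple_graph (V, E)"
    using G by (simp add: finite_simple_graph_def)
  moreover have "q_Ramsey q (complete_graph k) (V, E)"
    using q_Ramsey_complete_graph[OF _ G(3)] assms by simp
  \<comment> \<open>The graph \<open>(V, E)\<close> itself may fail to be minimal, so equivalence is
    applied to a minimal subgraph; the Ramsey property for the pendant graph then passes back up to
    \<open>(V, E)\<close>.\<close>
  ultimately obtain G' where G': "subgraph_of G' (V, E)" "q_Ramsey_minimal q (complete_graph k) G'"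
    using ex_q_Ramsey_minimal_subgraph by blast
  then have "G' \<in> Ramsey_minimal_graphs q (complete_graph k)"
    by (simp add: Ramsey_minimal_graphs_def subgraph_of_def)
  then have "G' \<in> Ramsey_minimal_graphs q (complete_graph_pendant k)"
    using eq by (simp only: q_equivalent_def)
  then have "q_Ramsey q (complete_graph_pendant k) G'"
    unfolding Ramsey_minimal_graphs_def q_Ramsey_minimal_def by blast
  then have "q_Ramsey q (complete_graph_pendant k) (V, E)"
    using G'(1) q_Ramsey_mono by blast
  then show False
    using not_q_Ramsey_complete_graph_pendant[OF _ G(4)] assms by simp
qed

end
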